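(* Let $\mathfrak{g}$ be a simple simply laced complex Lie algebra and let $\mathbf{i}\in R(w_0)$ be a reduced word. Let $\varsigma_{\mathbf{i}}=\sum_{i\in I}\varsigma_{\mathbf{i},i}$. The inequalities arising from $[\varsigma_{\mathbf{i},i}]_{trop}$ and $[\varsigma_{\mathbf{i},j}]_{trop}$ for $i\neq j$ are independent, i.e. the set of inequalities given by $[\varsigma_{\mathbf{i}}]_{trop}$ is non-redundant if and only if for every $i\in I$ the set of inequalities given by $[\varsigma_{\mathbf{i},i}]_{trop}$ is non-redundant.
   Context: Setting. $\mathfrak{g}$ has rank $n$, $I=\{1,\dots,n\}$, Cartan matrix $(c_{i,j})$, Weyl group $W$ with simple reflections $s_i$, longest element $w_0$ of length $N$. $R(w_0)$ is the set of reduced words $\mathbf{i}=(i_1,\dots,i_N)$ of $w_0$, i.e. $w_0=s_{i_1}\cdots s_{i_N}$. A word $\mathbf{j}$ is obtained from $\mathbf{i}$ by a $2$-term move at position $k$ if $(j_k,j_{k+1})=(i_{k+1},i_k)$, $c_{i_k,i_{k+1}}=0$, and all other letters agree; by a $3$-term move at position $k$ if $j_{k-1}=j_{k+1}=i_k$, $j_k=i_{k-1}=i_{k+1}$, $c_{i_k,i_{k+1}}=-1$, and all other letters agree. Any two elements of $R(w_0)$ are connected by such moves. String transition maps. If $\mathbf{j}$ arises from $\mathbf{i}$ by a $3$-term move at position $k$, the piecewise linear map $\Psi^{\mathbf{i}}_{\mathbf{j}}$, $x\mapsto x'$, is $x'_{k-1}=\max(x_{k+1},x_k-x_{k-1})$,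 $x'_k=x_{k-1}+x_{k+1}$, $x'_{k+1}=\min(x_{k-1},x_k-x_{k+1})$, other coordinates unchanged; for a $2$-term move at position $k$ it swaps $x_k$ and $x_{k+1}$. The subtraction-free birational lift $\widehat\Psi^{\mathbf{i}}_{\mathbf{j}}:(\mathbb{C}^* )^N\dashrightarrow(\mathbb{C}^* )^N$ is, for a $3$-term move, $x'_{k-1}=\frac{x_kx_{k+1}}{x_k+x_{k-1}x_{k+1}}$, $x'_k=x_{k-1}x_{k+1}$, $x'_{k+1}=x_{k-1}+\frac{x_k}{x_{k+1}}$, other coordinates unchanged, and for a $2$-term move the same swap; its tropicalization is $\Psi^{\mathbf{i}}_{\mathbf{j}}$. For arbitrary $\mathbf{i},\mathbf{j}$ one composes along a sequence of moves. The functions $\varsigma_{\mathbf{i},i}$ ($\mathbf{i}\in R(w_0)$, $i\in I$) are the rational functions in $x_1,\dots,x_N$ determined by: (1) if $i_N=i$ then $\varsigma_{\mathbf{i},i}(x)=x_N$; (2) $\varsigma_{\mathbf{i},i}\circ\widehat\Psi^{\mathbf{j}}_{\mathbf{i}}=\varsigma_{\mathbf{j},i}$ for all $\mathbf{i},\mathbf{j}\in R(w_0)$. They are Laurent polynomials with non-negative integer coefficients. Tropicalization: for a Laurent polynomial $f=\sum_u a_ux^u$ with coefficients $a_u\geq 0$, $[f]_{trop}(t)=\min_{u:\,a_u\ne0}\langle t,u\rangle$ with the standard inner product. The set of inequalities given by $[f]_{trop}$ is $\{\langle t,u\rangle\ge0 : a_u\neq0\}$ (one inequality per Laurent monomial of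 $f$). Such a set is redundant if for some monomial $x^{u_0}$ of $f$ the linear form $\langle\cdot,u_0\rangle$ is a linear combination with non-negative real coefficients of the linear forms $\langle\cdot,u\rangle$ of the other monomials $x^u$ of $f$; otherwise it is non-redundant. *)

theory Defs
  imports Complex_Main "HOL-Library.Poly_Mapping"
begin

section \<open>Complex Lie algebras and their Cartan matrices\<close>

locale complex_lie_algebra = vector_space scale
  for scale :: "complex \<Rightarrow> 'g::ab_group_add \<Rightarrow> 'g" (infixr \<open>*s\<close> 75) +
  fixes bracket :: "'g \<Rightarrow> 'g \<Rightarrow> 'g"
  assumes finite_dimensional: "\<exists>B. finite B \<and> span B = UNIV"
    and bracket_linear_left: "Vector_Spaces.linear scale scale (\<lambda>x. bracket x y)"
    and bracket_linear_right: "Vector_Spaces.linear scale scale (\<lambda>y. bracket x y)"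
    and bracket_alternating: "bracket x x = 0"
    and jacobi: "bracket x (bracket y z) + bracket y (bracket z x) + bracket z (bracket x y) = 0"
begin

definition lie_ideal :: "'g set \<Rightarrow> bool" where
  "lie_ideal K \<longleftrightarrow> subspace K \<and> (\<forall>x. \<forall>y\<in>K. bracket x y \<in> K)"

definition ad_diagonalizable :: "'g \<Rightarrow> bool" where
  "ad_diagonalizable h \<longleftrightarrow> span {x. \<exists>a. bracket h x = a *s x} = UNIV"

text \<open>For semisimple algebras: a Cartan subalgebra is a maximal commutative subalgebra all of whose
  elements are ad-diagonalizable.\<close>

definition cartan_subalgebra :: "'g set \<Rightarrow> bool" where
  "cartan_subalgebra H \<longleftrightarrow>
     subspace H \<and>
     (\<forall>h\<in>H. \<forall>h'\<in>H. bracket h h' = 0) \<and>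
     (\<forall>x. (\<forall>h\<in>H. bracket h x = 0) \<longrightarrow> x \<in> H) \<and>
     (\<forall>h\<in>H. ad_diagonalizable h)"

definition root_space :: "'g set \<Rightarrow> ('g \<Rightarrow> complex) \<Rightarrow> 'g set" where
  "root_space H \<alpha> = {x. \<forall>h\<in>H. bracket h x = \<alpha> h *s x}"

text \<open>A functional on \<open>H\<close> is encoded as a function vanishing outside \<open>H\<close>, so that roots are
  unique as functions. Linearity on \<open>H\<close> follows from the root space being nonzero.\<close>

definition roots :: "'g set \<Rightarrow> ('g \<Rightarrow> complex) set" where
  "roots H = {\<alpha>. (\<forall>h. h \<notin> H \<longrightarrow> \<alpha> h = 0) \<and> (\<exists>h. \<alpha> h \<noteq> 0) \<and> root_space H \<alpha> \<noteq> {0}}"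

definition simple_roots :: "'g set \<Rightarrow> nat \<Rightarrow> (nat \<Rightarrow> 'g \<Rightarrow> complex) \<Rightarrow> bool" where
  "simple_roots H n \<alpha> \<longleftrightarrow>
     (\<forall>i\<in>{1..n}. \<alpha> i \<in> roots H) \<and>
     (\<forall>a. (\<forall>h\<in>H. (\<Sum>i\<in>{1..n}. a i * \<alpha> i h) = 0) \<longrightarrow> (\<forall>i\<in>{1..n}. a i = 0)) \<and>
     (\<forall>\<beta>\<in>roots H. \<exists>m :: nat \<Rightarrow> nat.
        (\<forall>h. \<beta> h = (\<Sum>i\<in>{1..n}. of_nat (m i) * \<alpha> i h)) \<or>
        (\<forall>h. \<beta> h = - (\<Sum>i\<in>{1..n}. of_nat (m i) * \<alpha> i h)))"

definition coroot :: "'g set \<Rightarrow> ('g \<Rightarrow> complex) \<Rightarrow> 'g \<Rightarrow> bool" where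
  "coroot H \<alpha> h \<longleftrightarrow>
     (\<exists>x\<in>root_space H \<alpha>. \<exists>y\<in>root_space H (\<lambda>h. - \<alpha> h). h = bracket x y) \<and> \<alpha> h = 2"

definition cartan_matrix ::
  "'g set \<Rightarrow> nat \<Rightarrow> (nat \<Rightarrow> 'g \<Rightarrow> complex) \<Rightarrow> (nat \<Rightarrow> nat \<Rightarrow> int) \<Rightarrow> bool" where
  "cartan_matrix H n \<alpha> c \<longleftrightarrow>
     (\<exists>h. \<forall>i\<in>{1..n}. coroot H (\<alpha> i) (h i) \<and> (\<forall>j\<in>{1..n}. of_int (c i j) = \<alpha> j (h i)))"

end

locale simple_complex_lie_algebra = complex_lie_algebra +
  assumes not_abelian: "\<exists>x y. bracket x y \<noteq> 0"
    and ideals_trivial: "lie_ideal K \<Longrightarrow> K = {0} \<or> K = UNIV"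

definition simply_laced :: "nat \<Rightarrow> (nat \<Rightarrow> nat \<Rightarrow> int) \<Rightarrow> bool" where
  "simply_laced n c \<longleftrightarrow>
     (\<forall>i\<in>{1..n}. \<forall>j\<in>{1..n}. i \<noteq> j \<longrightarrow> c i j = c j i \<and> c i j \<in> {0, -1})"


section \<open>Weyl group and reduced words\<close>

text \<open>The Weyl group is realized by its faithful action on the root lattice: \<open>v\<close> stands for
  \<open>\<Sum>j\<in>{1..n}. v j * \<alpha> j\<close>, and the simple reflection sends \<open>\<alpha> j\<close> to \<open>\<alpha> j - c i j * \<alpha> i\<close>.\<close>

definition simple_reflection ::
  "nat \<Rightarrow> (nat \<Rightarrow> nat \<Rightarrow> int) \<Rightarrow> nat \<Rightarrow> (nat \<Rightarrow> int) \<Rightarrow> (nat \<Rightarrow> int)" where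
  "simple_reflection n c i v = v(i := v i - (\<Sum>j\<in>{1..n}. c i j * v j))"

definition word_product ::
  "nat \<Rightarrow> (nat \<Rightarrow> nat \<Rightarrow> int) \<Rightarrow> nat list \<Rightarrow> (nat \<Rightarrow> int) \<Rightarrow> (nat \<Rightarrow> int)" where
  "word_product n c ws = foldr (\<lambda>i w. simple_reflection n c i \<circ> w) ws id"

definition weyl_group :: "nat \<Rightarrow> (nat \<Rightarrow> nat \<Rightarrow> int) \<Rightarrow> ((nat \<Rightarrow> int) \<Rightarrow> (nat \<Rightarrow> int)) set" where
  "weyl_group n c = word_product n c ` lists {1..n}"

definition weyl_length ::
  "nat \<Rightarrow> (nat \<Rightarrow> nat \<Rightarrow> int) \<Rightarrow> ((nat \<Rightarrow> int) \<Rightarrow> (nat \<Rightarrow> int)) \<Rightarrow> nat" where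
  "weyl_length n c w = (LEAST m. \<exists>ws\<in>lists {1..n}. word_product n c ws = w \<and> length ws = m)"

definition longest_element ::
  "nat \<Rightarrow> (nat \<Rightarrow> nat \<Rightarrow> int) \<Rightarrow> ((nat \<Rightarrow> int) \<Rightarrow> (nat \<Rightarrow> int)) \<Rightarrow> bool" where
  "longest_element n c w \<longleftrightarrow>
     w \<in> weyl_group n c \<and> (\<forall>v\<in>weyl_group n c. weyl_length n c v \<le> weyl_length n c w)"

definition reduced_words ::
  "nat \<Rightarrow> (nat \<Rightarrow> nat \<Rightarrow> int) \<Rightarrow> ((nat \<Rightarrow> int) \<Rightarrow> (nat \<Rightarrow> int)) \<Rightarrow> nat list set" where
  "reduced_words n c w =
     {ws \<in> lists {1..n}. word_product n c ws = w \<and> length ws = weyl_length n c w}"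


section \<open>Moves and the birational string transition maps\<close>

text \<open>Positions in a word, and the coordinates of a point, are numbered from \<open>0\<close>.\<close>

definition two_term_move ::
  "(nat \<Rightarrow> nat \<Rightarrow> int) \<Rightarrow> nat \<Rightarrow> nat list \<Rightarrow> nat list \<Rightarrow> bool" where
  "two_term_move c k ws vs \<longleftrightarrow>
     k + 1 < length ws \<and> c (ws ! k) (ws ! (k + 1)) = 0 \<and>
     vs = ws[k := ws ! (k + 1), k + 1 := ws ! k]"

definition three_term_move ::
  "(nat \<Rightarrow> nat \<Rightarrow> int) \<Rightarrow> nat \<Rightarrow> nat list \<Rightarrow> nat list \<Rightarrow> bool" where
  "three_term_move c k ws vs \<longleftrightarrow>
     1 \<le> k \<and> k + 1 < length ws \<and>
     ws ! (k - 1) = ws ! (k + 1) \<and> c (ws ! k) (ws ! (k + 1)) = -1 \<and>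
     vs = ws[k - 1 := ws ! k, k := ws ! (k + 1), k + 1 := ws ! k]"

definition two_term_map :: "nat \<Rightarrow> (nat \<Rightarrow> complex) \<Rightarrow> (nat \<Rightarrow> complex)" where
  "two_term_map k x = x(k := x (k + 1), k + 1 := x k)"

definition three_term_map :: "nat \<Rightarrow> (nat \<Rightarrow> complex) \<Rightarrow> (nat \<Rightarrow> complex)" where
  "three_term_map k x =
     x(k - 1 := x k * x (k + 1) / (x k + x (k - 1) * x (k + 1)),
       k := x (k - 1) * x (k + 1),
       k + 1 := x (k - 1) + x k / x (k + 1))"

definition torus :: "nat \<Rightarrow> (nat \<Rightarrow> complex) set" where
  "torus N = {x. \<forall>k<N. x k \<noteq> 0}"

text \<open>\<open>transition c (ws, x) (vs, y)\<close>: some sequence of moves leads from \<open>ws\<close> to \<open>vs\<close>, and the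
  composite of the corresponding birational maps, all of which are defined at the points
  encountered, sends \<open>x\<close> to \<open>y\<close>. Each step maps points of the torus where it is defined to the torus.\<close>

inductive transition_step ::
  "(nat \<Rightarrow> nat \<Rightarrow> int) \<Rightarrow> nat list \<times> (nat \<Rightarrow> complex) \<Rightarrow> nat list \<times> (nat \<Rightarrow> complex) \<Rightarrow> bool"
  for c where
  two: "two_term_move c k ws vs \<Longrightarrow> transition_step c (ws, x) (vs, two_term_map k x)"
| three: "three_term_move c k ws vs \<Longrightarrow> x k + x (k - 1) * x (k + 1) \<noteq> 0 \<Longrightarrow>
    transition_step c (ws, x) (vs, three_term_map k x)"

definition transition ::
  "(nat \<Rightarrow> nat \<Rightarrow> int) \<Rightarrow> nat list \<times> (nat \<Rightarrow> complex) \<Rightarrow> nat list \<times> (nat \<Rightarrow> complex) \<Rightarrow> bool" where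
  "transition c = (transition_step c)\<^sup>*\<^sup>*"


section \<open>Laurent polynomials with non-negative integer coefficients\<close>

text \<open>Exponent vectors have type \<open>nat \<Rightarrow>\<^sub>0 int\<close>; \<open>Poly_Mapping.keys f\<close> is the set of exponents
  of the monomials of \<open>f\<close>.\<close>

type_synonym laurent = "(nat \<Rightarrow>\<^sub>0 int) \<Rightarrow>\<^sub>0 nat"

definition laurent_in :: "nat \<Rightarrow> laurent \<Rightarrow> bool" where
  "laurent_in N f \<longleftrightarrow> (\<forall>u\<in>Poly_Mapping.keys f. Poly_Mapping.keys u \<subseteq> {..<N})"

definition laurent_eval :: "nat \<Rightarrow> laurent \<Rightarrow> (nat \<Rightarrow> complex) \<Rightarrow> complex" where
  "laurent_eval N f x =
     (\<Sum>u\<in>Poly_Mapping.keys f.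
        of_nat (Poly_Mapping.lookup f u) * (\<Prod>k<N. x k powi Poly_Mapping.lookup u k))"

definition pairing :: "nat \<Rightarrow> (nat \<Rightarrow> real) \<Rightarrow> (nat \<Rightarrow>\<^sub>0 int) \<Rightarrow> real" where
  "pairing N t u = (\<Sum>k<N. t k * of_int (Poly_Mapping.lookup u k))"

text \<open>The tropicalization of \<open>f\<close> is the minimum of the linear forms \<open>\<lambda>t. pairing N t u\<close> over the
  monomials \<open>u\<close> of \<open>f\<close>; it gives the inequalities \<open>0 \<le> pairing N t u\<close>, one for each \<open>u\<close>.\<close>

definition redundant :: "nat \<Rightarrow> laurent \<Rightarrow> bool" where
  "redundant N f \<longleftrightarrow>
     (\<exists>u\<^sub>0\<in>Poly_Mapping.keys f. \<exists>a :: (nat \<Rightarrow>\<^sub>0 int) \<Rightarrow> real.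
        (\<forall>u\<in>Poly_Mapping.keys f - {u\<^sub>0}. 0 \<le> a u) \<and>
        (\<forall>t. pairing N t u\<^sub>0 = (\<Sum>u\<in>Poly_Mapping.keys f - {u\<^sub>0}. a u * pairing N t u)))"

text \<open>The equations are required at all torus points where the maps involved are defined, i.e. as
  identities of rational functions. They determine the family on reduced words and \<open>i \<in> {1..n}\<close>.\<close>

definition string_functions ::
  "nat \<Rightarrow> (nat \<Rightarrow> nat \<Rightarrow> int) \<Rightarrow> ((nat \<Rightarrow> int) \<Rightarrow> (nat \<Rightarrow> int)) \<Rightarrow>
    (nat list \<Rightarrow> nat \<Rightarrow> laurent) \<Rightarrow> bool" where
  "string_functions n c w\<^sub>0 \<sigma> \<longleftrightarrow>
     (let R = reduced_words n c w\<^sub>0; N = weyl_length n c w\<^sub>0 in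
       (\<forall>ws\<in>R. \<forall>i\<in>{1..n}. laurent_in N (\<sigma> ws i)) \<and>
       (\<forall>ws\<in>R. \<forall>i\<in>{1..n}. last ws = i \<longrightarrow>
          (\<forall>x\<in>torus N. laurent_eval N (\<sigma> ws i) x = x (N - 1))) \<and>
       (\<forall>ws\<in>R. \<forall>vs\<in>R. \<forall>i\<in>{1..n}. \<forall>x\<in>torus N. \<forall>y.
          transition c (vs, x) (ws, y) \<longrightarrow>
          laurent_eval N (\<sigma> ws i) y = laurent_eval N (\<sigma> vs i) x))"

end

theory Submission
  imports Defs
begin

text \<open>Give the variable \<open>x\<^sub>k\<close> the degree \<open>\<beta>\<^sub>k = s i\<^sub>N \<cdots> s i\<^bsub>k+1\<^esub> (\<alpha> i\<^sub>k)\<close> in the root lattice. The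
  transition maps preserve this grading, and every reduced word of the longest element is connected
  by moves to one ending in \<open>i\<close>, where the string function is the last variable, of degree
  \<open>\<alpha> i\<close>. Hence all monomials of the \<open>i\<close>-th string function have degree \<open>\<alpha> i\<close>, and as the simple
  roots are linearly independent, a non-negative relation between exponents of the sum involves
  only exponents of a single summand.\<close>

section \<open>Reflections\<close>

definition simple_root :: "nat \<Rightarrow> nat \<Rightarrow> int" where
  "simple_root i = (\<lambda>k. if k = i then 1 else 0)"

text \<open>Words and lengths are studied for the bare matrix; the Lie algebra enters only in the
  final theorem, where it supplies the diagonal entries.\<close>

locale simply_laced_cartan =
  fixes n :: nat and c :: "nat \<Rightarrow> nat \<Rightarrow> int"
  assumes diagonal: "i \<in> {1..n} \<Longrightarrow> c i i = 2"
    and laced: "simply_laced n c"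
begin

abbreviation s :: "nat \<Rightarrow> (nat \<Rightarrow> int) \<Rightarrow> nat \<Rightarrow> int" where
  "s \<equiv> simple_reflection n c"

abbreviation W :: "nat list \<Rightarrow> (nat \<Rightarrow> int) \<Rightarrow> nat \<Rightarrow> int" where
  "W \<equiv> word_product n c"

abbreviation len :: "((nat \<Rightarrow> int) \<Rightarrow> (nat \<Rightarrow> int)) \<Rightarrow> nat" where
  "len \<equiv> weyl_length n c"

lemma symmetric: "i \<in> {1..n} \<Longrightarrow> j \<in> {1..n} \<Longrightarrow> c i j = c j i"
  using laced unfolding simply_laced_def by metis

lemma off_diagonal:
  assumes "i \<in> {1..n}" "j \<in> {1..n}" "i \<noteq> j"
  obtains "c i j = 0" "c j i = 0" | "c i j = -1" "c j i = -1"
proof -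
  have "c i j = c j i \<and> c i j \<in> {0, -1}"
    using laced assms unfolding simply_laced_def by blast
  then show ?thesis using that by auto
qed

text \<open>The value of the \<open>i\<close>-th simple coroot on \<open>v\<close>; in terms of
  these values the relations between reflections become linear computations.\<close>

definition coweight :: "nat \<Rightarrow> (nat \<Rightarrow> int) \<Rightarrow> int" where
  "coweight i v = (\<Sum>j\<in>{1..n}. c i j * v j)"

lemma reflection_apply: "s i v k = v k - coweight i v * simple_root i k"
  by (auto simp: simple_reflection_def simple_root_def coweight_def)

lemma coweight_reflection:
  assumes "i \<in> {1..n}"
  shows "coweight j (s i v) = coweight j v - c j i * coweight i v"
proof -
  have "(\<Sum>k\<in>{1..n}. c j k * (coweight i v * simple_root i k)) = c j i * coweight i v"
    using assms by (simp add: simple_root_def if_distrib cong: if_cong)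
  moreover have "coweight j (s i v) =
      coweight j v - (\<Sum>k\<in>{1..n}. c j k * (coweight i v * simple_root i k))"
    unfolding coweight_def[of j] reflection_apply by (simp add: right_diff_distrib sum_subtractf)
  ultimately show ?thesis by simp
qed

lemma coweight_simple_root: "j \<in> {1..n} \<Longrightarrow> coweight i (simple_root j) = c i j"
  by (simp add: coweight_def simple_root_def if_distrib cong: if_cong)

lemma reflection_involution: "i \<in> {1..n} \<Longrightarrow> s i (s i v) = v"
  by (simp add: reflection_apply coweight_reflection diagonal fun_eq_iff algebra_simps)

lemma reflections_commute:
  "i \<in> {1..n} \<Longrightarrow> j \<in> {1..n} \<Longrightarrow> c i j = 0 \<Longrightarrow> s i (s j v) = s j (s i v)"
  using symmetric[of i j] by (simp add: reflection_apply coweight_reflection fun_eq_iff)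

lemma reflections_braid:
  "i \<in> {1..n} \<Longrightarrow> j \<in> {1..n} \<Longrightarrow> c i j = -1 \<Longrightarrow> s i (s j (s i v)) = s j (s i (s j v))"
  using symmetric[of i j]
  by (simp add: reflection_apply coweight_reflection diagonal fun_eq_iff algebra_simps)

lemma reflection_root_self: "i \<in> {1..n} \<Longrightarrow> s i (simple_root i) = (\<lambda>k. - simple_root i k)"
  by (simp add: reflection_apply coweight_simple_root diagonal fun_eq_iff)

lemma reflection_root_orthogonal:
  "j \<in> {1..n} \<Longrightarrow> c i j = 0 \<Longrightarrow> s i (simple_root j) = simple_root j"
  by (simp add: reflection_apply coweight_simple_root fun_eq_iff)

lemma reflection_root_adjacent:
  "j \<in> {1..n} \<Longrightarrow> c i j = -1 \<Longrightarrow> s i (simple_root j) = (\<lambda>k. simple_root i k + simple_root j k)"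
  by (simp add: reflection_apply coweight_simple_root fun_eq_iff)

lemma reflection_root_sum:
  assumes "i \<in> {1..n}" "j \<in> {1..n}" "c i j = -1"
  shows "s i (\<lambda>k. simple_root i k + simple_root j k) = simple_root j"
  using reflection_involution[OF assms(1), of "simple_root j"] reflection_root_adjacent assms by simp

section \<open>Words as operators on the root lattice\<close>

lemma word_product_Nil [simp]: "W [] = id"
  by (simp add: word_product_def)

lemma word_product_Cons [simp]: "W (a # ws) = s a \<circ> W ws"
  by (simp add: word_product_def)

lemma word_product_append [simp]: "W (ws @ vs) = W ws \<circ> W vs"
  by (induction ws) auto

lemma word_product_commute:
  assumes "a \<in> {1..n}" "b \<in> {1..n}" "c a b = 0"
  shows "W (p @ [a, b] @ q) = W (p @ [b, a] @ q)"
  by (simp add: comp_def reflections_commute[OF assms])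

lemma word_product_braid:
  assumes "a \<in> {1..n}" "b \<in> {1..n}" "c b a = -1"
  shows "W (p @ [a, b, a] @ q) = W (p @ [b, a, b] @ q)"
  by (simp add: comp_def reflections_braid[OF assms(2,1,3)])

lemma word_product_add: "W ws (\<lambda>k. u k + v k) = (\<lambda>k. W ws u k + W ws v k)"
  by (induction ws) (auto simp: simple_reflection_def fun_eq_iff sum.distrib algebra_simps)

lemma word_product_minus: "W ws (\<lambda>k. - v k) = (\<lambda>k. - W ws v k)"
  by (induction ws) (auto simp: simple_reflection_def fun_eq_iff sum_negf algebra_simps)


section \<open>Length and positivity of roots\<close>

lemma weyl_length_le: "ws \<in> lists {1..n} \<Longrightarrow> len (W ws) \<le> length ws"
  unfolding weyl_length_def by (rule Least_le) blast

lemma reduced_word_exists: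
  assumes "ws \<in> lists {1..n}"
  obtains vs where "vs \<in> lists {1..n}" "W vs = W ws" "length vs = len (W ws)"
proof -
  have "\<exists>vs\<in>lists {1..n}. W vs = W ws \<and> length vs = len (W ws)"
    unfolding weyl_length_def by (rule LeastI_ex) (use assms in blast)
  then show ?thesis using that by blast
qed

lemma weyl_length_snoc:
  assumes "ws \<in> lists {1..n}" "i \<in> {1..n}"
  shows "len (W (ws @ [i])) \<le> Suc (len (W ws))"
proof -
  obtain vs where "vs \<in> lists {1..n}" "W vs = W ws" "length vs = len (W ws)"
    using reduced_word_exists assms(1) by blast
  then show ?thesis
    using weyl_length_le[of "vs @ [i]"] assms(2) by simp
qed

lemma word_product_cancel: "i \<in> {1..n} \<Longrightarrow> W (ws @ [i, i]) = W ws"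
  by (auto simp: fun_eq_iff reflection_involution)

text \<open>This is the classical link between lengths and signs of roots. The induction splits off
  the last letter \<open>j\<close> of a reduced word and works in the rank two subgroup generated by
  the reflections in \<open>i\<close> and \<open>j\<close>. The inequality is non-strict so that it
  can be read off directly from length estimates.\<close>

lemma root_nonneg_if_length_le:
  assumes "ws \<in> lists {1..n}" "i \<in> {1..n}" "len (W ws) \<le> len (W (ws @ [i]))"
  shows "0 \<le> W ws (simple_root i) k"
  using assms
proof (induction "len (W ws)" arbitrary: ws i rule: less_induct)
  case less
  obtain vs where vs: "vs \<in> lists {1..n}" "W vs = W ws" "length vs = len (W ws)"
    using reduced_word_exists less.prems(1) by blast
  show ?case
  proof (cases vs rule: rev_exhaust)
    case Nil
    then show ?thesis using vs by (simp add: simple_root_def flip: vs(2))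
  next
    case (snoc us j)
    have us: "us \<in> lists {1..n}" and j: "j \<in> {1..n}" using vs snoc by auto
    have Wws: "W ws = W (us @ [j])" using vs snoc by simp
    have Wwsi: "W (ws @ [i]) = W (us @ [j, i])" using Wws by (simp add: comp_assoc)
    have lus: "Suc (len (W us)) \<le> len (W ws)"
      using weyl_length_le[OF us] vs snoc by simp
    have ij: "i \<noteq> j"
    proof
      assume "i = j"
      then have "W (ws @ [i]) = W us" using Wwsi word_product_cancel[OF j] by simp
      then show False using lus less.prems(3) by simp
    qed
    have usj: "0 \<le> W us (simple_root j) k"
      using less.hyps[OF _ us j] lus Wws by simp
    show ?thesis
      using less.prems(2) j ij
    proof (cases rule: off_diagonal)
      case 1
      \<comment> \<open>Moving \<open>j\<close> to the end changes the length by at most one, so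
        \<open>i\<close> cannot shorten \<open>us\<close>.\<close>
      have "W (ws @ [i]) = W ((us @ [i]) @ [j])"
        using word_product_commute[OF less.prems(2) j 1(1), of us "[]"] Wwsi by simp
      then have "len (W us) \<le> len (W (us @ [i]))"
        using weyl_length_snoc[of "us @ [i]" j] us j less.prems lus by simp
      then have "0 \<le> W us (simple_root i) k"
        using less.hyps[OF _ us less.prems(2)] lus by simp
      then show ?thesis
        using Wws reflection_root_orthogonal[OF less.prems(2) 1(2)] by simp
    next
      case 2
      have root: "W ws (simple_root i) = W us (\<lambda>k. simple_root j k + simple_root i k)"
        using Wws reflection_root_adjacent[OF less.prems(2) 2(2)] by simp
      show ?thesis
      proof (cases "len (W us) \<le> len (W (us @ [i]))")
        case True
        then have "0 \<le> W us (simple_root i) k"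
          using less.hyps[OF _ us less.prems(2)] lus by simp
        then show ?thesis using usj root by (simp add: word_product_add)
      next
        case False
        \<comment> \<open>When \<open>i\<close> shortens \<open>us\<close>, the root is rewritten as
          the image of the simple root of \<open>j\<close> under the shorter element.\<close>
        let ?u = "us @ [i]"
        have u: "?u \<in> lists {1..n}" using us less.prems by simp
        have "(\<lambda>k. simple_root j k + simple_root i k) = s i (simple_root j)"
          using reflection_root_adjacent[OF j 2(1)] by (simp add: add.commute)
        then have root2: "W ws (simple_root i) = W ?u (simple_root j)"
          using root by simp
        have "len (W ?u) \<le> len (W (?u @ [j]))"
        proof (rule ccontr)
          assume *: "\<not> ?thesis"
          \<comment> \<open>Inserting \<open>[j, j]\<close> creates \<open>[j, i, j]\<close>, to
            which the braid relation applies. If \<open>j\<close> shortened \<open>?u\<close> too,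
            two further reflections would not bring the length back up to that of
            \<open>W ws\<close>.\<close>
          have eq: "W (ws @ [i]) = W (((?u @ [j]) @ [i]) @ [j])"
            using Wwsi word_product_cancel[OF j, of "us @ [j, i]"]
              word_product_braid[OF j less.prems(2) 2(1), of us "[j]"] by simp
          have "len (W (((?u @ [j]) @ [i]) @ [j])) \<le> Suc (Suc (len (W (?u @ [j]))))"
            using weyl_length_snoc[of "(?u @ [j]) @ [i]" j] weyl_length_snoc[of "?u @ [j]" i]
              u j less.prems(2) by simp
          then show False
            using * False lus less.prems(3) unfolding eq by linarith
        qed
        then have "0 \<le> W ?u (simple_root j) k"
          using less.hyps[OF _ u j] lus False by simp
        then show ?thesis using root2 by simp
      qed
    qed
  qed
qed


section \<open>Braid moves\<close>

text \<open>The moves without coordinates, given by a split of the word instead of a position, so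
  that appending and reversing become list algebra.\<close>

inductive braid_move :: "nat list \<Rightarrow> nat list \<Rightarrow> bool" where
  commute: "c a b = 0 \<Longrightarrow> braid_move (p @ [a, b] @ q) (p @ [b, a] @ q)"
| braid: "c b a = -1 \<Longrightarrow> braid_move (p @ [a, b, a] @ q) (p @ [b, a, b] @ q)"

text \<open>Entry \<open>k\<close> is the image of the simple root of letter \<open>k\<close> under
  the product of the preceding letters. For a reduced word these are the positive roots that the
  inverse of the product makes negative.\<close>

fun inversions :: "nat list \<Rightarrow> (nat \<Rightarrow> int) list" where
  "inversions [] = []"
| "inversions (a # ws) = simple_root a # map (s a) (inversions ws)"

lemma inversions_append: "inversions (ws @ vs) = inversions ws @ map (W ws) (inversions vs)"
  by (induction ws) auto

lemma length_inversions [simp]: "length (inversions ws) = length ws"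
  by (induction ws) auto

lemma inversions_commute:
  assumes "a \<in> {1..n}" "b \<in> {1..n}" "c a b = 0"
  shows "inversions (p @ [a, b] @ q) = inversions p @
      [W p (simple_root a), W p (simple_root b)] @ map (W (p @ [a, b])) (inversions q)"
  using reflection_root_orthogonal[OF assms(2,3)] by (simp add: inversions_append)

text \<open>The two sides of the braid relation run through the same three roots of a system of type
  A2, in opposite orders.\<close>

lemma inversions_braid:
  assumes "a \<in> {1..n}" "b \<in> {1..n}" "c a b = -1"
  shows "inversions (p @ [a, b, a] @ q) = inversions p @
      [W p (simple_root a), (\<lambda>k. W p (simple_root a) k + W p (simple_root b) k), W p (simple_root b)]
      @ map (W (p @ [a, b, a])) (inversions q)"
proof -
  have ba: "c b a = -1" using symmetric assms by simp
  have "s b (simple_root a) = (\<lambda>k. simple_root a k + simple_root b k)"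
    using reflection_root_adjacent[OF assms(1) ba] by (simp add: add.commute)
  then have "s a (s b (simple_root a)) = simple_root b"
    using reflection_root_sum[OF assms] by simp
  then show ?thesis
    using reflection_root_adjacent[OF assms(2,3)]
    by (simp add: inversions_append word_product_add)
qed

text \<open>The set of inversions is tracked because it carries their positivity to every word
  reached by moves.\<close>

lemma braid_move_invariants:
  assumes "braid_move ws vs" "ws \<in> lists {1..n}"
  shows "vs \<in> lists {1..n}" "W vs = W ws" "length vs = length ws"
    "set (inversions vs) = set (inversions ws)"
proof -
  have "vs \<in> lists {1..n} \<and> W vs = W ws \<and> length vs = length ws \<and>
    set (inversions vs) = set (inversions ws)"
    using assms
  proof (cases rule: braid_move.cases)
    case (commute a b p q)
    then have ab: "a \<in> {1..n}" "b \<in> {1..n}" using assms by auto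
    then have ba: "c b a = 0" using symmetric commute by simp
    show ?thesis
      unfolding commute inversions_commute[OF ab commute(3)] inversions_commute[OF ab(2,1) ba]
      using word_product_commute[OF ab commute(3), of p] assms(2) commute
      by (auto simp del: word_product_append)
  next
    case (braid b a p q)
    then have ab: "a \<in> {1..n}" "b \<in> {1..n}" using assms by auto
    then have ba: "c a b = -1" using symmetric braid by simp
    show ?thesis
      unfolding braid inversions_braid[OF ab ba] inversions_braid[OF ab(2,1) braid(3)]
      using word_product_braid[OF ab braid(3), of p] assms(2) braid
      by (auto simp del: word_product_append simp: add.commute)
  qed
  then show "vs \<in> lists {1..n}" "W vs = W ws" "length vs = length ws"
    "set (inversions vs) = set (inversions ws)" by auto
qed

lemma braid_moves_invariants:
  assumes "braid_move\<^sup>*\<^sup>* ws vs" "ws \<in> lists {1..n}"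
  shows "vs \<in> lists {1..n} \<and> W vs = W ws \<and> length vs = length ws \<and>
    set (inversions vs) = set (inversions ws)"
  using assms by (induction rule: rtranclp_induct) (use braid_move_invariants in auto)

lemma braid_moves_append:
  assumes "braid_move\<^sup>*\<^sup>* ws vs"
  shows "braid_move\<^sup>*\<^sup>* (ws @ r) (vs @ r)"
  using assms
proof (induction rule: rtranclp_induct)
  case (step us vs)
  from step(2) have "braid_move (us @ r) (vs @ r)"
  proof cases
    case (commute a b p q)
    then show ?thesis using braid_move.commute[of a b p "q @ r"] by simp
  next
    case (braid b a p q)
    then show ?thesis using braid_move.braid[of b a p "q @ r"] by simp
  qed
  then show ?case using step by simp
qed simp

text \<open>This is the part of Tits' theorem on the connectedness of reduced words that is needed:
  positivity of the inversions plays the role of reducedness.\<close>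

lemma braid_moves_to_descent:
  assumes "ws \<in> lists {1..n}" "\<forall>v\<in>set (inversions ws). \<forall>k. 0 \<le> v k"
    and "i \<in> {1..n}" "\<And>k. W ws (simple_root i) k \<le> 0"
  shows "\<exists>us. braid_move\<^sup>*\<^sup>* ws (us @ [i])"
  using assms
proof (induction "length ws" arbitrary: ws i rule: less_induct)
  case less
  show ?case
  proof (cases ws rule: rev_exhaust)
    case Nil
    then have "simple_root i i \<le> 0" using less.prems(4)[of i] by simp
    then show ?thesis by (simp add: simple_root_def)
  next
    case (snoc us j)
    have us: "us \<in> lists {1..n}" and j: "j \<in> {1..n}" using less.prems snoc by auto
    have pos: "\<forall>v\<in>set (inversions us). \<forall>k. 0 \<le> v k"
      using less.prems(2) snoc by (simp add: inversions_append)
    have posj: "0 \<le> W us (simple_root j) k" for k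
      using less.prems(2) snoc by (simp add: inversions_append)
    show ?thesis
    proof (cases "i = j")
      case True
      then show ?thesis using snoc by blast
    next
      case False
      with less.prems(3) j show ?thesis
      proof (cases rule: off_diagonal)
        case 1
        have "W us (simple_root i) k \<le> 0" for k
          using less.prems(4)[of k] snoc reflection_root_orthogonal[OF less.prems(3) 1(2)] by simp
        then obtain vs where "braid_move\<^sup>*\<^sup>* us (vs @ [i])"
          using less.hyps[OF _ us pos less.prems(3)] snoc by auto
        from braid_moves_append[OF this, of "[j]"] have "braid_move\<^sup>*\<^sup>* ws (vs @ [i, j])"
          using snoc by simp
        moreover have "braid_move (vs @ [i, j]) (vs @ [j, i])"
          using braid_move.commute[of i j vs "[]"] 1 by simp
        ultimately have "braid_move\<^sup>*\<^sup>* ws ((vs @ [j]) @ [i])" by simp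
        then show ?thesis by blast
      next
        case 2
        have sum: "W us (simple_root j) k + W us (simple_root i) k \<le> 0" for k
          using less.prems(4)[of k] snoc reflection_root_adjacent[OF less.prems(3) 2(2)]
          by (simp add: word_product_add)
        \<comment> \<open>The image of the root of \<open>j\<close> is itself an inversion, hence
          nonnegative, while the sum is nonpositive.\<close>
        have "W us (simple_root i) k \<le> 0" for k
          using sum[of k] posj[of k] by linarith
        then obtain vs where vs: "braid_move\<^sup>*\<^sup>* us (vs @ [i])"
          using less.hyps[OF _ us pos less.prems(3)] snoc by auto
        have inv: "vs @ [i] \<in> lists {1..n}" "W (vs @ [i]) = W us" "length (vs @ [i]) = length us"
          "set (inversions (vs @ [i])) = set (inversions us)"
          using braid_moves_invariants[OF vs us] by auto
        have posvs: "\<forall>v\<in>set (inversions vs). \<forall>k. 0 \<le> v k"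
          using pos inv(4) by (auto simp: inversions_append)
        \<comment> \<open>Since \<open>vs @ [i]\<close> has the product of \<open>us\<close>, and
          \<open>s i\<close> sends the sum of the two simple roots to the root of \<open>j\<close>,
          the sign of the sum passes to \<open>vs\<close>.\<close>
        have "W vs (simple_root j) k \<le> 0" for k
        proof -
          have "W us (\<lambda>k. simple_root i k + simple_root j k) = W vs (simple_root j)"
            using reflection_root_sum[OF less.prems(3) j 2(1)] by (simp flip: inv(2))
          then show ?thesis using sum[of k] by (simp add: word_product_add fun_eq_iff add.commute)
        qed
        then obtain xs where "braid_move\<^sup>*\<^sup>* vs (xs @ [j])"
          using less.hyps[OF _ _ posvs j] snoc inv by auto
        \<comment> \<open>The two uses of the induction hypothesis produce the ending
          \<open>[j, i, j]\<close>, which one braid move turns into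
          \<open>[i, j, i]\<close>.\<close>
        from braid_moves_append[OF this, of "[i, j]"] braid_moves_append[OF vs, of "[j]"]
        have "braid_move\<^sup>*\<^sup>* ws (xs @ [j, i, j])"
          using snoc by simp
        moreover have "braid_move (xs @ [j, i, j]) (xs @ [i, j, i])"
          using braid_move.braid[of i j xs "[]"] 2 by simp
        ultimately have "braid_move\<^sup>*\<^sup>* ws ((xs @ [i, j]) @ [i])" by simp
        then show ?thesis by blast
      qed
    qed
  qed
qed

text \<open>A prefix of a reduced word is reduced, and the last inversion is the root of a step that
  does not decrease the length.\<close>

lemma reduced_inversions_nonneg:
  assumes "ws \<in> lists {1..n}" "length ws = len (W ws)" "v \<in> set (inversions ws)"
  shows "0 \<le> v k"
  using assms
proof (induction ws arbitrary: v rule: rev_induct)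
  case (snoc a ws)
  have ws: "ws \<in> lists {1..n}" and a: "a \<in> {1..n}" using snoc.prems by auto
  have l: "length ws = len (W ws)" "len (W ws) \<le> len (W (ws @ [a]))"
    using weyl_length_snoc[OF ws a] weyl_length_le[OF ws] snoc.prems(2)
    by (simp_all del: word_product_append)
  show ?case
    using snoc.IH[OF ws l(1)] root_nonneg_if_length_le[OF ws a l(2)] snoc.prems(3)
    by (auto simp: inversions_append)
qed simp

text \<open>By maximality, appending \<open>i\<close> to \<open>ws @ [i]\<close> does not decrease
  the length. The sign criterion applies to that product, and reflecting back makes the image of the
  root of \<open>i\<close> under \<open>w\<close> nonpositive.\<close>

lemma longest_word_descent:
  assumes "longest_element n c w" "ws \<in> reduced_words n c w" "i \<in> {1..n}"
  shows "\<exists>us. braid_move\<^sup>*\<^sup>* ws (us @ [i])"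
proof -
  have ws: "ws \<in> lists {1..n}" "W ws = w" "length ws = len w"
    using assms(2) by (auto simp: reduced_words_def)
  have wsi: "ws @ [i] \<in> lists {1..n}" using ws assms by simp
  then have "len (W (ws @ [i])) \<le> len w"
    using assms(1) unfolding longest_element_def weyl_group_def by blast
  then have "len (W (ws @ [i])) \<le> len (W ((ws @ [i]) @ [i]))"
    using word_product_cancel[OF assms(3), of ws] ws by simp
  then have "0 \<le> W (ws @ [i]) (simple_root i) k" for k
    using root_nonneg_if_length_le[OF wsi assms(3)] by simp
  then have "W ws (simple_root i) k \<le> 0" for k
    by (simp add: reflection_root_self[OF assms(3)] word_product_minus)
  then show ?thesis
    using braid_moves_to_descent[OF ws(1) _ assms(3)] reduced_inversions_nonneg[OF ws(1)] ws
    by simp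
qed


section \<open>The grading by roots\<close>

text \<open>The degree of a variable involves the letters after it; the double reversal turns these
  into the prefixes used by \<open>inversions\<close>.\<close>

definition degrees :: "nat list \<Rightarrow> (nat \<Rightarrow> int) list" where
  "degrees ws = rev (inversions (rev ws))"

lemma length_degrees [simp]: "length (degrees ws) = length ws"
  by (simp add: degrees_def)

lemma degrees_last: "degrees (us @ [i]) ! length us = simple_root i"
  by (simp add: degrees_def nth_append)

lemma degrees_commute:
  assumes "a \<in> {1..n}" "b \<in> {1..n}" "c a b = 0"
  shows "\<exists>P u v Q. length P = length p \<and> degrees (p @ [a, b] @ q) = P @ [u, v] @ Q \<and>
    degrees (p @ [b, a] @ q) = P @ [v, u] @ Q"
proof -
  have ba: "c b a = 0" using symmetric assms by simp
  \<comment> \<open>\<open>P\<close> comes from the letters before the move. Reversal puts them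
    after it, where the equal products of both sides give the same list.\<close>
  show ?thesis
    using inversions_commute[OF assms, of "rev q" "rev p"]
      inversions_commute[OF assms(2,1) ba, of "rev q" "rev p"]
      word_product_commute[OF assms, of "rev q" "[]"]
    unfolding degrees_def
    by (intro exI[of _ "rev (map (W (rev q @ [a, b])) (inversions (rev p)))"] exI conjI)
      (auto simp del: word_product_append)
qed

text \<open>This is what makes the three-term map homogeneous: with degrees \<open>u\<close>,
  \<open>u + v\<close>, \<open>v\<close>, the middle variable and the product of the outer ones both
  have degree \<open>u + v\<close>, so the new variables have degrees \<open>v\<close>,
  \<open>u + v\<close>, \<open>u\<close>.\<close>

lemma degrees_braid:
  assumes "a \<in> {1..n}" "b \<in> {1..n}" "c b a = -1"
  shows "\<exists>P u v Q. length P = length p \<and>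
    degrees (p @ [a, b, a] @ q) = P @ [u, \<lambda>k. u k + v k, v] @ Q \<and>
    degrees (p @ [b, a, b] @ q) = P @ [v, \<lambda>k. u k + v k, u] @ Q"
proof -
  have ab: "c a b = -1" using symmetric assms by simp
  show ?thesis
    using inversions_braid[OF assms(1,2) ab, of "rev q" "rev p"]
      inversions_braid[OF assms(2,1,3), of "rev q" "rev p"]
      word_product_braid[OF assms, of "rev q" "[]"]
    unfolding degrees_def
    by (intro exI[of _ "rev (map (W (rev q @ [a, b, a])) (inversions (rev p)))"] exI conjI)
      (auto simp del: word_product_append simp: add.commute)
qed

section \<open>Transition maps along the curves of the grading\<close>

lemma transition_commute:
  assumes "c a b = 0"
  shows "transition_step c (p @ [a, b] @ q, x) (p @ [b, a] @ q, two_term_map (length p) x)"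
  using assms by (intro transition_step.two)
    (simp add: two_term_move_def nth_append list_update_append)

text \<open>A three-term move is indexed by its middle letter, hence the position
  \<open>Suc (length p)\<close>.\<close>

lemma transition_braid:
  assumes "c b a = -1"
    and "x (Suc (length p)) + x (length p) * x (Suc (Suc (length p))) \<noteq> 0"
  shows "transition_step c (p @ [a, b, a] @ q, x)
    (p @ [b, a, b] @ q, three_term_map (Suc (length p)) x)"
  using assms by (intro transition_step.three)
    (simp_all add: three_term_move_def nth_append list_update_append)

text \<open>The point \<open>y\<close> moved by \<open>r\<close> under the one-parameter group that
  weights each variable by coordinate \<open>j\<close> of its degree. Positivity of \<open>y\<close>
  keeps the transition maps defined when \<open>r > 0\<close>.\<close>

definition scaled_point :: "nat list \<Rightarrow> nat \<Rightarrow> (nat \<Rightarrow> real) \<Rightarrow> real \<Rightarrow> (nat \<Rightarrow> complex) \<Rightarrow> bool" where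
  "scaled_point ws j y r z \<longleftrightarrow>
    (\<forall>k<length ws. y k > 0 \<and> z k = of_real (r powi ((degrees ws ! k) j) * y k))"

lemma scaled_point_commute:
  assumes ab: "a \<in> {1..n}" "b \<in> {1..n}" "c a b = 0"
    and z: "scaled_point (p @ [a, b] @ q) j y r z"
  shows "scaled_point (p @ [b, a] @ q) j
    (y(length p := y (Suc (length p)), Suc (length p) := y (length p))) r
    (two_term_map (length p) z)"
proof -
  obtain P u v Q where deg: "length P = length p" "degrees (p @ [a, b] @ q) = P @ [u, v] @ Q"
    "degrees (p @ [b, a] @ q) = P @ [v, u] @ Q"
    using degrees_commute[OF ab] by blast
  have zk: "y k > 0 \<and> z k = of_real (r powi (((P @ [u, v] @ Q) ! k) j) * y k)"
    if "k < length (p @ [a, b] @ q)" for k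
    using z that unfolding scaled_point_def deg(2) by blast
  have same: "(P @ [u, v] @ Q) ! k = (P @ [v, u] @ Q) ! k"
    if "k \<noteq> length p" "k \<noteq> Suc (length p)" for k
    using that deg(1) by (auto simp: nth_append nth_Cons split: nat.splits)
  show ?thesis
    unfolding scaled_point_def deg(3)
  proof (intro allI impI)
    fix k assume k: "k < length (p @ [b, a] @ q)"
    consider "k = length p" | "k = Suc (length p)" | "k \<noteq> length p" "k \<noteq> Suc (length p)" by blast
    then show "0 < (y(length p := y (Suc (length p)), Suc (length p) := y (length p))) k \<and>
      two_term_map (length p) z k = of_real (r powi (((P @ [v, u] @ Q) ! k) j) *
        (y(length p := y (Suc (length p)), Suc (length p) := y (length p))) k)"
    proof cases
      case 1
      then show ?thesis using zk[of "Suc (length p)"] deg(1)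
        by (simp add: two_term_map_def nth_append)
    next
      case 2
      then show ?thesis using zk[of "length p"] deg(1)
        by (simp add: two_term_map_def nth_append)
    next
      case 3
      then show ?thesis using zk[of k] same[OF 3] k
        by (simp add: two_term_map_def)
    qed
  qed
qed

text \<open>The three-term map on real points, indexed by the left letter \<open>m\<close> instead
  of the middle one.\<close>

definition three_term_real :: "nat \<Rightarrow> (nat \<Rightarrow> real) \<Rightarrow> nat \<Rightarrow> real" where
  "three_term_real m y =
    y(m := y (Suc m) * y (Suc (Suc m)) / (y (Suc m) + y m * y (Suc (Suc m))),
      Suc m := y m * y (Suc (Suc m)),
      Suc (Suc m) := y m + y (Suc m) / y (Suc (Suc m)))"

text \<open>Both summands of the denominator scale alike and are positive, so it does not vanish,
  and the scaling factors can be pulled out of all three new coordinates.\<close>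

lemma scaled_point_braid:
  assumes ab: "a \<in> {1..n}" "b \<in> {1..n}" "c b a = -1" and r: "r > 0"
    and z: "scaled_point (p @ [a, b, a] @ q) j y r z"
  shows "z (Suc (length p)) + z (length p) * z (Suc (Suc (length p))) \<noteq> 0"
    and "scaled_point (p @ [b, a, b] @ q) j (three_term_real (length p) y) r
      (three_term_map (Suc (length p)) z)"
proof -
  obtain P u v Q where deg: "length P = length p"
    "degrees (p @ [a, b, a] @ q) = P @ [u, \<lambda>k. u k + v k, v] @ Q"
    "degrees (p @ [b, a, b] @ q) = P @ [v, \<lambda>k. u k + v k, u] @ Q"
    using degrees_braid[OF ab] by blast
  define m where "m = length p"
  define y1 y2 y3 where y_def: "y1 = y m" "y2 = y (Suc m)" "y3 = y (Suc (Suc m))"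
  \<comment> \<open>These are the scaling factors of the outer variables; the middle one scales by
    \<open>d * e\<close>.\<close>
  define d e where de_def: "d = r powi (u j)" "e = r powi (v j)"
  have zk: "y k > 0 \<and> z k = of_real (r powi (((P @ [u, \<lambda>k. u k + v k, v] @ Q) ! k) j) * y k)"
    if "k < length (p @ [a, b, a] @ q)" for k
    using z that unfolding scaled_point_def deg(2) by blast
  have same: "(P @ [u, \<lambda>k. u k + v k, v] @ Q) ! k = (P @ [v, \<lambda>k. u k + v k, u] @ Q) ! k"
    if "k \<noteq> m" "k \<noteq> Suc m" "k \<noteq> Suc (Suc m)" for k
    using that deg(1) m_def by (auto simp: nth_append nth_Cons split: nat.splits)
  have de: "d > 0" "e > 0" "r powi (u j + v j) = d * e"
    using r by (auto simp: de_def power_int_add)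
  have y: "y1 > 0" "y2 > 0" "y3 > 0"
    using zk[of m] zk[of "Suc m"] zk[of "Suc (Suc m)"] by (auto simp: y_def m_def)
  have z1: "z m = of_real (d * y1)"
    using zk[of m] deg(1) by (simp add: m_def y_def de_def nth_append)
  have z2: "z (Suc m) = of_real (d * e * y2)"
    using zk[of "Suc m"] deg(1) de(3) by (simp add: m_def y_def nth_append)
  have z3: "z (Suc (Suc m)) = of_real (e * y3)"
    using zk[of "Suc (Suc m)"] deg(1) by (simp add: m_def y_def de_def nth_append)
  have sum: "z (Suc m) + z m * z (Suc (Suc m)) = of_real (d * e * (y2 + y1 * y3))"
    unfolding z1 z2 z3 of_real_mult[symmetric] of_real_add[symmetric] by (simp add: algebra_simps)
  have pos: "y2 + y1 * y3 > 0" using y by (simp add: add_pos_pos)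
  show "z (Suc (length p)) + z (length p) * z (Suc (Suc (length p))) \<noteq> 0"
    using sum pos de unfolding m_def[symmetric] by (simp del: of_real_add of_real_mult)
  have t1: "z (Suc m) * z (Suc (Suc m)) / (z (Suc m) + z m * z (Suc (Suc m))) =
      of_real (e * (y2 * y3 / (y2 + y1 * y3)))"
  proof -
    have "d * e * y2 * (e * y3) / (d * e * (y2 + y1 * y3)) = e * (y2 * y3 / (y2 + y1 * y3))"
    proof -
      have "d * e * y2 * (e * y3) = (d * e) * (e * (y2 * y3))" by simp
      then show ?thesis using de by (simp only: mult_divide_mult_cancel_left_if) simp
    qed
    then show ?thesis
      unfolding sum unfolding z2 z3 of_real_mult[symmetric] of_real_divide[symmetric]
      by (simp only:)
  qed
  have t2: "z m * z (Suc (Suc m)) = of_real (d * e * (y1 * y3))"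
    unfolding z1 z3 by simp
  have t3: "z m + z (Suc m) / z (Suc (Suc m)) = of_real (d * (y1 + y2 / y3))"
    unfolding z1 z2 z3 of_real_divide[symmetric] of_real_add[symmetric]
    using de y by (simp add: field_simps)
  show "scaled_point (p @ [b, a, b] @ q) j (three_term_real (length p) y) r
      (three_term_map (Suc (length p)) z)"
    unfolding scaled_point_def deg(3) m_def[symmetric]
  proof (intro allI impI)
    fix k assume k: "k < length (p @ [b, a, b] @ q)"
    consider "k = m" | "k = Suc m" | "k = Suc (Suc m)" | "k \<noteq> m" "k \<noteq> Suc m" "k \<noteq> Suc (Suc m)"
      by blast
    then show "0 < three_term_real m y k \<and> three_term_map (Suc m) z k =
      of_real (r powi (((P @ [v, \<lambda>k. u k + v k, u] @ Q) ! k) j) * three_term_real m y k)"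
    proof cases
      case 1
      then show ?thesis using t1 y pos deg(1) m_def
        by (simp add: three_term_map_def three_term_real_def nth_append y_def de_def)
    next
      case 2
      then show ?thesis using t2 y de(3) deg(1) m_def
        by (simp add: three_term_map_def three_term_real_def nth_append y_def de_def)
    next
      case 3
      then show ?thesis using t3 y deg(1) m_def
        by (simp add: three_term_map_def three_term_real_def nth_append add_pos_pos y_def de_def)
    next
      case 4
      then show ?thesis using zk[of k] same[OF 4] k
        by (simp add: three_term_map_def three_term_real_def)
    qed
  qed
qed

text \<open>The order of quantifiers matters: \<open>y\<close> does not depend on \<open>r\<close>,
  so each final coordinate is a constant times a power of \<open>r\<close>.\<close>

lemma transition_scaled_points:
  assumes "braid_move\<^sup>*\<^sup>* ws vs" "ws \<in> lists {1..n}"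
  shows "\<exists>y. \<forall>r>0. \<exists>z. transition c (ws, \<lambda>k. of_real (r powi ((degrees ws ! k) j))) (vs, z) \<and>
    scaled_point vs j y r z"
  using assms
proof (induction rule: rtranclp_induct)
  case base
  show ?case
    unfolding transition_def
    by (intro exI[of _ "\<lambda>_. 1"] allI impI exI conjI) (auto simp: scaled_point_def)
next
  case (step us vs)
  have us: "us \<in> lists {1..n}" using braid_moves_invariants[OF step(1,4)] by simp
  obtain y where y: "\<And>r. r > 0 \<Longrightarrow> \<exists>z. transition c
      (ws, \<lambda>k. of_real (r powi ((degrees ws ! k) j))) (us, z) \<and> scaled_point us j y r z"
    using step by blast
  from step(2) show ?case
  proof cases
    case (commute a b p q)
    then have ab: "a \<in> {1..n}" "b \<in> {1..n}" using us by auto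
    show ?thesis
    proof (intro exI[of _ "y(length p := y (Suc (length p)), Suc (length p) := y (length p))"]
        allI impI)
      fix r :: real assume "r > 0"
      then obtain z where z: "transition c
          (ws, \<lambda>k. of_real (r powi ((degrees ws ! k) j))) (us, z)" "scaled_point us j y r z"
        using y by blast
      then show "\<exists>z. transition c
          (ws, \<lambda>k. of_real (r powi ((degrees ws ! k) j))) (vs, z) \<and> scaled_point vs j
            (y(length p := y (Suc (length p)), Suc (length p) := y (length p))) r z"
        using transition_commute[OF commute(3), of p q z] scaled_point_commute[OF ab commute(3)]
        unfolding transition_def commute by (meson rtranclp.rtrancl_into_rtrancl)
    qed
  next
    case (braid b a p q)
    then have ab: "a \<in> {1..n}" "b \<in> {1..n}" using us by auto
    show ?thesis
    proof (intro exI[of _ "three_term_real (length p) y"] allI impI)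
      fix r :: real assume r: "r > 0"
      then obtain z where z: "transition c
          (ws, \<lambda>k. of_real (r powi ((degrees ws ! k) j))) (us, z)" "scaled_point us j y r z"
        using y by blast
      then show "\<exists>z. transition c
          (ws, \<lambda>k. of_real (r powi ((degrees ws ! k) j))) (vs, z) \<and> scaled_point vs j
            (three_term_real (length p) y) r z"
        using transition_braid[OF braid(3), of z p q] scaled_point_braid[OF ab braid(3) r]
        unfolding transition_def braid by (meson rtranclp.rtrancl_into_rtrancl)
    qed
  qed
qed

end


section \<open>Homogeneity\<close>

text \<open>Positive coefficients exclude cancellation, so every single term is bounded by the whole
  sum. A different exponent would break this bound for large or for small \<open>r\<close>.\<close>

lemma exponents_eq_if_homogeneous:
  fixes a :: "'a \<Rightarrow> real" and e :: "'a \<Rightarrow> int"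
  assumes "finite A" "\<And>u. u \<in> A \<Longrightarrow> a u > 0"
    and hom: "\<And>r. r > 0 \<Longrightarrow> (\<Sum>u\<in>A. a u * r powi e u) = C * r powi m"
    and u: "u \<in> A"
  shows "e u = m"
proof -
  have bound: "r powi (e u - m) \<le> C / a u" if "r > 0" for r
  proof -
    have "a u * r powi e u \<le> (\<Sum>u\<in>A. a u * r powi e u)"
      using assms that by (intro member_le_sum) (auto intro: mult_nonneg_nonneg less_imp_le)
    also have "\<dots> = C * r powi m" by (rule hom[OF that])
    finally have "a u * (r powi (e u - m)) \<le> C"
      using that by (simp add: power_int_diff field_simps)
    then show ?thesis using assms(2)[OF u] by (simp add: field_simps)
  qed
  \<comment> \<open>This \<open>t\<close> exceeds both 1 and the bound. It refutes an exponent that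
    is too large, and \<open>inverse t\<close> one that is too small.\<close>
  define t where "t = max 1 (C / a u) + 1"
  have t: "t > 1" "t > C / a u" unfolding t_def by linarith+
  have grow: "t \<le> t powi d" if "d > 0" for d
    using power_int_increasing[of 1 d t] that t by simp
  show ?thesis
  proof (rule ccontr)
    assume "e u \<noteq> m"
    then consider "e u - m > 0" | "m - e u > 0" by linarith
    then show False
    proof cases
      case 1
      then show False using bound[of t] grow t by fastforce
    next
      case 2
      have "inverse t powi (e u - m) = t powi (m - e u)"
        by (metis minus_diff_eq power_int_inverse power_int_minus)
      then show False using bound[of "inverse t"] grow[OF 2] t by simp
    qed
  qed
qed

lemma laurent_eval_monomial_curve:
  assumes "r > 0"
  shows "laurent_eval N f (\<lambda>k. of_real (r powi d k)) = of_real (\<Sum>u\<in>Poly_Mapping.keys f.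
    of_nat (Poly_Mapping.lookup f u) * r powi (\<Sum>k<N. d k * Poly_Mapping.lookup u k))"
proof -
  have "(\<Prod>k<N. complex_of_real (r powi d k) powi Poly_Mapping.lookup u k) =
      of_real (r powi (\<Sum>k<N. d k * Poly_Mapping.lookup u k))" for u
    by (induction N) (use assms in \<open>simp_all add: power_int_add power_int_mult\<close>)
  then show ?thesis by (simp add: laurent_eval_def)
qed

text \<open>The degree is tested one coordinate \<open>j\<close> at a time, by following the string
  function along the corresponding curve to a word ending in \<open>i\<close>.\<close>

lemma (in simply_laced_cartan) string_function_homogeneous:
  assumes "longest_element n c w" "string_functions n c w \<sigma>" "ws \<in> reduced_words n c w"
    and i: "i \<in> {1..n}" and u: "u \<in> Poly_Mapping.keys (\<sigma> ws i)"
  shows "(\<Sum>k<len w. (degrees ws ! k) j * Poly_Mapping.lookup u k) = simple_root i j"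
proof -
  let ?X = "\<lambda>r k. complex_of_real (r powi ((degrees ws ! k) j))"
  have ws: "ws \<in> lists {1..n}" "W ws = w" "length ws = len w"
    using assms(3) by (auto simp: reduced_words_def)
  obtain us where us: "braid_move\<^sup>*\<^sup>* ws (us @ [i])"
    using longest_word_descent assms by blast
  have vs: "us @ [i] \<in> reduced_words n c w"
    using braid_moves_invariants[OF us ws(1)] ws by (simp add: reduced_words_def)
  then have N: "len w = Suc (length us)" by (simp add: reduced_words_def)
  obtain y where y: "\<And>r. r > 0 \<Longrightarrow> \<exists>z. transition c (ws, ?X r) (us @ [i], z) \<and>
      scaled_point (us @ [i]) j y r z"
    using transition_scaled_points[OF us ws(1), of j] by blast
  have "(\<Sum>u\<in>Poly_Mapping.keys (\<sigma> ws i). real (Poly_Mapping.lookup (\<sigma> ws i) u) *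
      r powi (\<Sum>k<len w. (degrees ws ! k) j * Poly_Mapping.lookup u k)) =
      y (length us) * r powi (simple_root i j)" if r: "r > 0" for r
  proof -
    obtain z where z: "transition c (ws, ?X r) (us @ [i], z)" "scaled_point (us @ [i]) j y r z"
      using y[OF r] by blast
    have "z k \<noteq> 0" if "k < len w" for k
      using z(2) that r N unfolding scaled_point_def by fastforce
    then have "z \<in> torus (len w)" by (simp add: torus_def)
    moreover have "?X r \<in> torus (len w)" using r by (simp add: torus_def)
    \<comment> \<open>Compatibility with transitions moves the evaluation to
      \<open>us @ [i]\<close>, where the normalization makes the string function the last
      coordinate, at index \<open>len w - 1 = length us\<close>.\<close>
    ultimately have "laurent_eval (len w) (\<sigma> ws i) (?X r) = z (len w - 1)"
      using assms(2,3) vs i z(1) unfolding string_functions_def Let_def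
      by (metis last_snoc)
    also have "\<dots> = of_real (r powi (simple_root i j) * y (length us))"
      using z(2) N unfolding scaled_point_def by (simp add: degrees_last)
    finally show ?thesis
      unfolding laurent_eval_monomial_curve[OF r] of_real_eq_iff by (simp add: mult.commute)
  qed
  then show ?thesis
    by (rule exponents_eq_if_homogeneous[rotated 2, OF _ u])
      (auto simp: in_keys_iff)
qed

section \<open>Redundancy of sums of Laurent polynomials\<close>

lemma keys_sum_nat:
  fixes f :: "'a \<Rightarrow> 'b \<Rightarrow>\<^sub>0 nat"
  assumes "finite A"
  shows "Poly_Mapping.keys (\<Sum>i\<in>A. f i) = (\<Union>i\<in>A. Poly_Mapping.keys (f i))"
  using assms by (auto simp: in_keys_iff lookup_sum)

text \<open>The vectors \<open>t j\<close> separate the summands: evaluating a relation at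
  \<open>t j\<close> adds up the coefficients it gives to monomials of the \<open>j\<close>-th
  summand.\<close>

lemma redundant_sum_iff:
  fixes f :: "nat \<Rightarrow> laurent" and t :: "nat \<Rightarrow> nat \<Rightarrow> real"
  assumes "finite A"
    and deg: "\<And>i j u. i \<in> A \<Longrightarrow> j \<in> A \<Longrightarrow> u \<in> Poly_Mapping.keys (f i) \<Longrightarrow>
      pairing N (t j) u = (if i = j then 1 else 0)"
  shows "redundant N (\<Sum>i\<in>A. f i) \<longleftrightarrow> (\<exists>i\<in>A. redundant N (f i))"
proof
  let ?K = "\<lambda>i. Poly_Mapping.keys (f i)"
  let ?U = "\<Union>i\<in>A. ?K i"
  assume "redundant N (\<Sum>i\<in>A. f i)"
  then obtain u0 a where u0: "u0 \<in> ?U" and a: "\<And>u. u \<in> ?U - {u0} \<Longrightarrow> 0 \<le> a u"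
    and eq: "\<And>t. pairing N t u0 = (\<Sum>u\<in>?U - {u0}. a u * pairing N t u)"
    unfolding redundant_def keys_sum_nat[OF assms(1)] by blast
  from u0 obtain i where i: "i \<in> A" "u0 \<in> ?K i" by blast
  have finU: "finite (?U - {u0})" using assms(1) by simp
  \<comment> \<open>At \<open>t j\<close> the left side of the relation vanishes, so a sum of
    nonnegative terms is zero and each term is.\<close>
  have zero: "a u = 0" if j: "j \<in> A" "j \<noteq> i" "u \<in> ?K j" for j u
  proof -
    have u: "u \<in> ?U - {u0}" using j i deg[of j j u] deg[of i j u0] by auto
    have "(\<Sum>u\<in>?U - {u0}. a u * pairing N (t j) u) = 0"
      using eq[of "t j"] deg[OF i(1) j(1) i(2)] j by simp
    moreover have "0 \<le> a u * pairing N (t j) u" if "u \<in> ?U - {u0}" for u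
      using a[OF that] that deg[OF _ j(1)] by auto
    ultimately have "a u * pairing N (t j) u = 0"
      using sum_nonneg_eq_0_iff[OF finU, of "\<lambda>u. a u * pairing N (t j) u"] u by blast
    then show ?thesis using deg[OF j(1,1,3)] by simp
  qed
  have "pairing N t u0 = (\<Sum>u\<in>?K i - {u0}. a u * pairing N t u)" for t
    unfolding eq by (rule sum.mono_neutral_right[OF finU]) (use i zero in auto)
  then have "redundant N (f i)"
    unfolding redundant_def using i a by blast
  then show "\<exists>i\<in>A. redundant N (f i)" using i by blast
next
  let ?K = "\<lambda>i. Poly_Mapping.keys (f i)"
  let ?U = "\<Union>i\<in>A. ?K i"
  assume "\<exists>i\<in>A. redundant N (f i)"
  then obtain i u0 a where i: "i \<in> A" "u0 \<in> ?K i"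
    and a: "\<And>u. u \<in> ?K i - {u0} \<Longrightarrow> 0 \<le> a u"
    and eq: "\<And>t. pairing N t u0 = (\<Sum>u\<in>?K i - {u0}. a u * pairing N t u)"
    unfolding redundant_def by blast
  \<comment> \<open>A relation within one summand extends by zero to the monomials of the
    others.\<close>
  define b where "b u = (if u \<in> ?K i then a u else 0)" for u
  have "pairing N t u0 = (\<Sum>u\<in>?U - {u0}. b u * pairing N t u)" for t
    unfolding eq using i assms(1) by (intro sum.mono_neutral_cong_left) (auto simp: b_def)
  moreover have "0 \<le> b u" if "u \<in> ?U - {u0}" for u
    using a that by (auto simp: b_def)
  ultimately show "redundant N (\<Sum>i\<in>A. f i)"
    unfolding redundant_def keys_sum_nat[OF assms(1)] using i by blast
qed

theorem proposition1:
  fixes scale :: "complex \<Rightarrow> 'g::ab_group_add \<Rightarrow> 'g"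
    and bracket :: "'g \<Rightarrow> 'g \<Rightarrow> 'g"
    and H :: "'g set"
    and n :: nat
    and \<alpha> :: "nat \<Rightarrow> 'g \<Rightarrow> complex"
    and c :: "nat \<Rightarrow> nat \<Rightarrow> int"
    and w\<^sub>0 :: "(nat \<Rightarrow> int) \<Rightarrow> (nat \<Rightarrow> int)"
    and \<sigma> :: "nat list \<Rightarrow> nat \<Rightarrow> laurent"
    and ws :: "nat list"
  assumes "simple_complex_lie_algebra scale bracket"
    and "complex_lie_algebra.cartan_subalgebra scale bracket H"
    and "complex_lie_algebra.simple_roots scale bracket H n \<alpha>"
    and "complex_lie_algebra.cartan_matrix scale bracket H n \<alpha> c"
    and "simply_laced n c"
    and "longest_element n c w\<^sub>0"
    and "string_functions n c w\<^sub>0 \<sigma>"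
    and "ws \<in> reduced_words n c w\<^sub>0"
  shows "\<not> redundant (weyl_length n c w\<^sub>0) (\<Sum>i\<in>{1..n}. \<sigma> ws i) \<longleftrightarrow>
    (\<forall>i\<in>{1..n}. \<not> redundant (weyl_length n c w\<^sub>0) (\<sigma> ws i))"
proof -
  interpret complex_lie_algebra scale bracket
    using assms(1) by (simp add: simple_complex_lie_algebra_def)
  have "c i i = 2" if i: "i \<in> {1..n}" for i
  proof -
    obtain h where "coroot H (\<alpha> i) (h i)" "of_int (c i i) = \<alpha> i (h i)"
      using assms(4) i unfolding cartan_matrix_def by blast
    then have "(of_int (c i i) :: complex) = of_int 2" by (simp add: coroot_def)
    then show ?thesis unfolding of_int_eq_iff .
  qed
  then interpret cartan: simply_laced_cartan n c
    using assms(5) by unfold_locales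
  \<comment> \<open>Pairing an exponent with \<open>?t j\<close> reads off the coefficient of the
    simple root of \<open>j\<close> in the degree of its monomial.\<close>
  let ?t = "\<lambda>j k. real_of_int ((cartan.degrees ws ! k) j)"
  have "pairing (weyl_length n c w\<^sub>0) (?t j) u = (if i = j then 1 else 0)"
    if "i \<in> {1..n}" "u \<in> Poly_Mapping.keys (\<sigma> ws i)" for i j u
  proof -
    have "pairing (weyl_length n c w\<^sub>0) (?t j) u = of_int (simple_root i j)"
      unfolding cartan.string_function_homogeneous[OF assms(6,7,8) that, symmetric]
      by (simp add: pairing_def)
    then show ?thesis by (simp add: simple_root_def)
  qed
  then show ?thesis
    using redundant_sum_iff[of "{1..n}" "\<sigma> ws" "weyl_length n c w\<^sub>0" ?t] by auto
qed

end
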